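(* Let $F:\mathbb{R}^n\to\mathbb{R}^n$ be a piecewise linear function given in abs-normal form with data $c,b,Z,L,J,Y$ and $s$ switching variables, where $J$ is nonsingular and $s\le n$. Then the following are equivalent: 1. $F$ is stably coherently oriented; 2. $F$ is stably bijective; 3. $F$ is coherently oriented under small perturbations of $Z,L,J,Y,c,b$; 4. $F$ is bijective under small perturbations of $Z,L,J,Y,c,b$; 5. the absolute value equation associated to $F$ is uniquely solvable, i.e. with $S=L-ZJ^{-1}Y$ the equation $z-S|z|=\hat c$ has exactly one solution $z\in\mathbb{R}^s$ for every $\hat c\in\mathbb{R}^s$.
   Context: Abs-normal form (ANF): $F:\mathbb{R}^n\to\mathbb{R}^n$, $y=F(x)$, is given by $$\begin{bmatrix} z\\ y\end{bmatrix}=\begin{bmatrix} c\\ b\end{bmatrix}+\begin{bmatrix} Z& L\\ J& Y\end{bmatrix}\begin{bmatrix} x\\ |z|\end{bmatrix},$$ with $c\in\mathbb{R}^s$, $Z\in\mathbb{R}^{s\times n}$, $L\in\mathbb{R}^{s\times s}$ strictly lower triangular, $b\in\mathbb{R}^n$, $J\in\mathbb{R}^{n\times n}$, $Y\in\mathbb{R}^{n\times s}$, and $|z|$ the componentwise absolute value; since $L$ is strictly lower triangular, $z=z(x)$ (the vector of switching variables) is uniquely determined by $x$. The absolute value equation (AVE) associated to the ANF is $z-S|z|=\hat c$ with $S=L-ZJ^{-1}Y$. A continuous function $F:\mathbb{R}^n\to\mathbb{R}^n$ is piecewise linear if there are finitely many affine selection functions $F_i(x)=A_ix+b_i$ such that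 at each $x$ it coincides with some $F_i$. It is coherently oriented if the linear parts $A_i$ of all selection functions that coincide with $F$ on some nonempty open set have determinants of the same nonzero sign. A piecewise linear function in ANF is stably coherently oriented (resp. stably bijective) if all functions obtained by sufficiently small perturbations of $Z$ (the other ANF data kept fixed) are also coherently oriented (resp. bijective), i.e. there is $\varepsilon>0$ such that this holds for all $\tilde Z\in\mathbb{R}^{s\times n}$ with $\|\tilde Z-Z\|<\varepsilon$. Similarly, a property holds under small perturbations of $Z,L,J,Y,c,b$ if there is $\varepsilon>0$ such that it holds for all ANFs of the same dimensions (with $L$ remaining strictly lower triangular) whose data differ from the given ones by less than $\varepsilon$. *)

theory Defs
  imports "HOL-Analysis.Analysis"
begin

text \<open>Order matters only for the switching variables, whose index type is therefore a finite
  well-order (as for the triangular matrices in the library's determinant theory).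
  The bars on vectors below are the library's componentwise absolute value.\<close>

definition strictly_lower_triangular ::
  "real^('s::{finite,wellorder})^('s::{finite,wellorder}) \<Rightarrow> bool" where
  "strictly_lower_triangular L \<longleftrightarrow> (\<forall>i j. i \<le> j \<longrightarrow> L $ i $ j = 0)"

text \<open>The description is meaningful only for strictly lower triangular \<open>L\<close>;
  see \<open>anf_switching_ex1\<close>.\<close>

definition anf_switching ::
  "real^('s::{finite,wellorder}) \<Rightarrow> real^'n^('s::{finite,wellorder})
    \<Rightarrow> real^('s::{finite,wellorder})^('s::{finite,wellorder}) \<Rightarrow> real^'n
    \<Rightarrow> real^('s::{finite,wellorder})" where
  "anf_switching c Z L x = (THE z. z = c + Z *v x + L *v \<bar>z\<bar>)"

definition anf_fun ::
  "real^('s::{finite,wellorder}) \<Rightarrow> real^'n \<Rightarrow> real^'n^('s::{finite,wellorder})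
    \<Rightarrow> real^('s::{finite,wellorder})^('s::{finite,wellorder}) \<Rightarrow> real^'n^'n
    \<Rightarrow> real^('s::{finite,wellorder})^'n \<Rightarrow> real^'n \<Rightarrow> real^'n" where
  "anf_fun c b Z L J Y x = b + J *v x + Y *v \<bar>anf_switching c Z L x\<bar>"

definition affine_selections ::
  "((real^'n^'n) \<times> (real^'n)) set \<Rightarrow> (real^'n \<Rightarrow> real^'n) \<Rightarrow> bool" where
  "affine_selections S F \<longleftrightarrow> finite S \<and> (\<forall>x. \<exists>(A, b) \<in> S. F x = A *v x + b)"

definition piecewise_linear :: "(real^'n \<Rightarrow> real^'n) \<Rightarrow> bool" where
  "piecewise_linear F \<longleftrightarrow> continuous_on UNIV F \<and> (\<exists>S. affine_selections S F)"

definition coincides_on_open :: "(real^'n \<Rightarrow> real^'n) \<Rightarrow> real^'n^'n \<Rightarrow> real^'n \<Rightarrow> bool" where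
  "coincides_on_open F A b \<longleftrightarrow> (\<exists>U. open U \<and> U \<noteq> {} \<and> (\<forall>x\<in>U. F x = A *v x + b))"

text \<open>The choice of the selection functions does not matter; see \<open>coherently_oriented_iff\<close>.\<close>

definition coherently_oriented :: "(real^'n \<Rightarrow> real^'n) \<Rightarrow> bool" where
  "coherently_oriented F \<longleftrightarrow> piecewise_linear F \<and>
    (\<exists>S. affine_selections S F \<and>
      (\<exists>\<sigma>\<in>{-1, 1}. \<forall>(A, b)\<in>S. coincides_on_open F A b \<longrightarrow> sgn (det A) = \<sigma>))"

definition anf_stably_Z ::
  "((real^'n \<Rightarrow> real^'n) \<Rightarrow> bool)
    \<Rightarrow> real^('s::{finite,wellorder}) \<Rightarrow> real^'n \<Rightarrow> real^'n^('s::{finite,wellorder})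
    \<Rightarrow> real^('s::{finite,wellorder})^('s::{finite,wellorder}) \<Rightarrow> real^'n^'n
    \<Rightarrow> real^('s::{finite,wellorder})^'n \<Rightarrow> bool" where
  "anf_stably_Z P c b Z L J Y \<longleftrightarrow>
    (\<exists>\<epsilon>>0. \<forall>Z'. norm (Z' - Z) < \<epsilon> \<longrightarrow> P (anf_fun c b Z' L J Y))"

definition anf_stably ::
  "((real^'n \<Rightarrow> real^'n) \<Rightarrow> bool)
    \<Rightarrow> real^('s::{finite,wellorder}) \<Rightarrow> real^'n \<Rightarrow> real^'n^('s::{finite,wellorder})
    \<Rightarrow> real^('s::{finite,wellorder})^('s::{finite,wellorder}) \<Rightarrow> real^'n^'n
    \<Rightarrow> real^('s::{finite,wellorder})^'n \<Rightarrow> bool" where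
  "anf_stably P c b Z L J Y \<longleftrightarrow>
    (\<exists>\<epsilon>>0. \<forall>c' b' Z' L' J' Y'.
      strictly_lower_triangular L' \<and>
      norm (c' - c) < \<epsilon> \<and> norm (b' - b) < \<epsilon> \<and> norm (Z' - Z) < \<epsilon> \<and>
      norm (L' - L) < \<epsilon> \<and> norm (J' - J) < \<epsilon> \<and> norm (Y' - Y) < \<epsilon> \<longrightarrow>
      P (anf_fun c' b' Z' L' J' Y'))"

definition ave_uniquely_solvable ::
  "real^('s::{finite,wellorder})^('s::{finite,wellorder}) \<Rightarrow> bool" where
  "ave_uniquely_solvable S \<longleftrightarrow> (\<forall>c. \<exists>!z. z - S *v \<bar>z\<bar> = c)"

lemma strictly_lower_triangular_abs_eq_ex1:
  fixes L :: "real^('s::{finite,wellorder})^('s::{finite,wellorder})"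
  assumes L: "strictly_lower_triangular L"
  shows "\<exists>!z. z = d + L *v \<bar>z\<bar>"
proof -
  have L0: "L $ i $ j = 0" if "i \<le> j" for i j
    using L that by (auto simp: strictly_lower_triangular_def)
  have mv: "(L *v \<bar>z\<bar>) $ i = (\<Sum>j\<in>{..<i}. L $ i $ j * \<bar>z $ j\<bar>)" for z i
  proof -
    have "(\<Sum>j\<in>UNIV. L $ i $ j * \<bar>z $ j\<bar>) = (\<Sum>j\<in>{..<i}. L $ i $ j * \<bar>z $ j\<bar>)"
      by (rule sum.mono_neutral_right) (simp_all add: L0 not_less)
    then show ?thesis by (simp add: matrix_vector_mult_def abs_vec_def)
  qed
  define R where "R = {(i::'s, j). i < j}"
  have wfR: "wf R" unfolding R_def by (rule wf)
  define H where "H = (\<lambda>f i. d $ i + (\<Sum>j\<in>{..<i}. L $ i $ j * \<bar>f j\<bar>))"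
  define g where "g = wfrec R H"
  have g: "g i = H g i" for i
  proof -
    have "g i = H (cut g R i) i"
      unfolding g_def by (rule wfrec[OF wfR])
    also have "\<dots> = H g i"
      unfolding H_def by (intro arg_cong2[where f="(+)"] sum.cong refl) (auto simp: cut_apply R_def)
    finally show ?thesis .
  qed
  show ?thesis
  proof (rule ex1I[where a="\<chi> i. g i"])
    show "(\<chi> i. g i) = d + L *v \<bar>\<chi> i. g i\<bar>"
      by (subst vec_eq_iff) (simp add: mv g[unfolded H_def, symmetric])
  next
    fix z assume z: "z = d + L *v \<bar>z\<bar>"
    have zi: "z $ i = d $ i + (\<Sum>j\<in>{..<i}. L $ i $ j * \<bar>z $ j\<bar>)" for i
      using arg_cong[OF z, of "\<lambda>v. v $ i"] by (simp only: vector_add_component mv)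
    have "z $ i = g i" for i
    proof (induction i rule: less_induct)
      case (less i)
      have "(\<Sum>j\<in>{..<i}. L $ i $ j * \<bar>z $ j\<bar>) = (\<Sum>j\<in>{..<i}. L $ i $ j * \<bar>g j\<bar>)"
        by (rule sum.cong) (simp_all add: less.IH)
      then have "z $ i = H g i"
        unfolding H_def using zi[of i] by (simp only:)
      then show ?case using g[of i] by (simp only:)
    qed
    then show "z = (\<chi> i. g i)" by (simp add: vec_eq_iff)
  qed
qed

lemma anf_switching_ex1:
  assumes "strictly_lower_triangular L"
  shows "\<exists>!z. z = c + Z *v x + L *v \<bar>z\<bar>"
  using strictly_lower_triangular_abs_eq_ex1[OF assms] .

lemma anf_switching_eq:
  assumes "strictly_lower_triangular L"
  shows "anf_switching c Z L x = c + Z *v x + L *v \<bar>anf_switching c Z L x\<bar>"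
  unfolding anf_switching_def by (rule theI'[OF anf_switching_ex1[OF assms]])

lemma affine_eq_on_open:
  fixes A B :: "real^'n^'n"
  assumes U: "open U" "U \<noteq> {}" and eq: "\<And>x. x \<in> U \<Longrightarrow> A *v x + a = B *v x + b"
  shows "A = B"
proof -
  obtain x e where xe: "e > 0" "ball x e \<subseteq> U"
    using U by (metis all_not_in_conv openE)
  have "(A - B) *v v = 0" for v
  proof -
    define t where "t = e / (2 * (norm v + 1))"
    have n0: "0 < norm v + 1" by (smt (verit) norm_ge_zero)
    have t: "t > 0" using xe n0 by (simp add: t_def)
    have "t * (2 * (norm v + 1)) = e" using n0 by (simp add: t_def)
    then have "2 * (t * norm v) + 2 * t = e" by (simp only: algebra_simps)
    moreover have "0 \<le> t * norm v" using t by simp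
    ultimately have "t * norm v < e" using t by linarith
    then have "norm (t *\<^sub>R v) < e" using t by simp
    then have "x + t *\<^sub>R v \<in> U" "x \<in> U"
      using xe by (auto simp: dist_norm subset_iff)
    from eq[OF this(1)] eq[OF this(2)]
    have "A *v (x + t *\<^sub>R v) - A *v x = B *v (x + t *\<^sub>R v) - B *v x"
      by (metis add_diff_cancel_right)
    then have "A *v (t *\<^sub>R v) = B *v (t *\<^sub>R v)"
      by (simp add: matrix_vector_right_distrib)
    then have "t *\<^sub>R ((A - B) *v v) = 0"
      by (simp add: matrix_vector_mult_diff_rdistrib matrix_vector_mult_scaleR algebra_simps)
    then show ?thesis using t by simp
  qed
  then have "A - B = 0"
    by (metis matrix_eq matrix_vector_mult_0)
  then show ?thesis by simp
qed

lemma finite_Union_closed_interior: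
  assumes "finite I" "\<And>i. i \<in> I \<Longrightarrow> closed (C i)" "interior (\<Union>i\<in>I. C i) \<noteq> {}"
  shows "\<exists>i\<in>I. interior (C i) \<noteq> {}"
  using assms
proof (induction I rule: finite_induct)
  case (insert i I)
  show ?case
  proof (cases "interior (\<Union>i\<in>I. C i) = {}")
    case True
    have "closed (C i)" using insert by auto
    then have "interior (C i \<union> (\<Union>i\<in>I. C i)) = interior (C i)"
      using True by (rule interior_closed_Un_empty_interior)
    with insert show ?thesis by auto
  next
    case False
    with insert show ?thesis by auto
  qed
qed auto

lemma affine_selections_open:
  fixes F :: "real^'n \<Rightarrow> real^'n"
  assumes S: "affine_selections S F" and AB: "coincides_on_open F A b"
  shows "\<exists>b'. (A, b') \<in> S \<and> coincides_on_open F A b'"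
proof -
  obtain U where U: "open U" "U \<noteq> {}" "\<And>x. x \<in> U \<Longrightarrow> F x = A *v x + b"
    using AB by (auto simp: coincides_on_open_def)
  define C where "C = (\<lambda>p. {x. A *v x + b = fst p *v x + snd p})"
  have UC: "U \<subseteq> (\<Union>p\<in>S. C p)"
  proof
    fix x assume "x \<in> U"
    obtain p where "p \<in> S" "F x = fst p *v x + snd p"
      using S unfolding affine_selections_def split_beta by blast
    then show "x \<in> (\<Union>p\<in>S. C p)"
      using U(3)[OF \<open>x \<in> U\<close>] by (intro UN_I[of p]) (simp_all add: C_def)
  qed
  obtain x e where xe: "e > 0" "cball x e \<subseteq> U"
    using U by (metis all_not_in_conv open_contains_cball)
  have clC: "closed (C p)" for p
    unfolding C_def by (intro closed_Collect_eq continuous_intros)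
  have "cball x e \<subseteq> (\<Union>p\<in>S. C p \<inter> cball x e)"
    using xe UC by blast
  then have "interior (cball x e) \<subseteq> interior (\<Union>p\<in>S. C p \<inter> cball x e)"
    by (rule interior_mono)
  moreover have "x \<in> interior (cball x e)"
    using xe by simp
  ultimately have "interior (\<Union>p\<in>S. C p \<inter> cball x e) \<noteq> {}"
    by blast
  then obtain p where p: "p \<in> S" "interior (C p \<inter> cball x e) \<noteq> {}"
    using finite_Union_closed_interior[of S "\<lambda>p. C p \<inter> cball x e"] S clC
    by (auto simp: affine_selections_def closed_Int)
  define V where "V = interior (C p \<inter> cball x e)"
  have "V \<subseteq> C p \<inter> cball x e"
    unfolding V_def by (rule interior_subset)
  then have V: "open V" "V \<noteq> {}" "V \<subseteq> C p" "V \<subseteq> U"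
    using p(2) xe(2) by (auto simp: V_def)
  have "A = fst p"
    using V(1,2) by (rule affine_eq_on_open) (use V in \<open>auto simp: C_def\<close>)
  moreover have "coincides_on_open F (fst p) (snd p)"
    unfolding coincides_on_open_def
    by (rule exI[of _ V]) (use V U in \<open>auto simp: C_def subset_iff\<close>)
  ultimately show ?thesis
    using p by (intro exI[of _ "snd p"]) auto
qed

lemma coherently_oriented_iff:
  fixes F :: "real^'n \<Rightarrow> real^'n"
  assumes S: "affine_selections S F" and F: "continuous_on UNIV F"
  shows "coherently_oriented F \<longleftrightarrow>
    (\<exists>\<sigma>\<in>{-1, 1}. \<forall>(A, b)\<in>S. coincides_on_open F A b \<longrightarrow> sgn (det A) = \<sigma>)" (is "_ \<longleftrightarrow> ?R")
proof
  assume ?R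
  then show "coherently_oriented F"
    using S F unfolding coherently_oriented_def piecewise_linear_def by blast
next
  assume "coherently_oriented F"
  then obtain T \<sigma> where T: "affine_selections T F" "\<sigma> \<in> {-1, 1}"
    "\<And>A b. (A, b) \<in> T \<Longrightarrow> coincides_on_open F A b \<Longrightarrow> sgn (det A) = \<sigma>"
    unfolding coherently_oriented_def by blast
  then have "\<forall>(A, b)\<in>S. coincides_on_open F A b \<longrightarrow> sgn (det A) = \<sigma>"
    using affine_selections_open[OF T(1)] by blast
  with T(2) show ?R by blast
qed

end

theory Submission
  imports Defs "HOL-Computational_Algebra.Polynomial"
begin

text \<open>Replace \<open>\<bar>z\<bar>\<close> by \<open>D z\<close> with \<open>D\<close> diagonal and entries in \<open>[-1, 1]\<close>, and call the data regular if the
  resulting homogeneous linear system in \<open>(x, z)\<close> has only the trivial solution for every such \<open>D\<close>.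
  Differences \<open>\<bar>z\<^sub>1\<bar> - \<bar>z\<^sub>2\<bar>\<close> are exactly the vectors \<open>D (z\<^sub>1 - z\<^sub>2)\<close>, so regularity means injectivity of
  the absolute value equation; surjectivity follows by invariance of domain. Compactness of the cube
  makes regularity an open condition on the data. The Jacobian \<open>A\<^sub>D\<close> of the piece belonging to \<open>D\<close> has
  a determinant that is affine in each entry of \<open>D\<close>, so that regularity is equivalent to all vertices
  of the cube giving determinants of one nonzero sign. If \<open>Z\<close> is surjective, every sign pattern of \<open>z\<close>
  occurs on an open set and both bijectivity and coherent orientation force regularity. Finally, a
  singular triple \<open>(D, x, z)\<close> has \<open>Z x \<noteq> 0\<close> and survives a perturbation of \<open>Z\<close> that fixes \<open>Z x\<close>; as
  \<open>s \<le> n\<close>, such a perturbation can be chosen surjective.\<close>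

text \<open>The componentwise product \<open>d * z\<close> plays the role of \<open>D z\<close>.\<close>

definition regular ::
  "real^'n^('s::finite) \<Rightarrow> real^'s^'s \<Rightarrow> real^'n^'n \<Rightarrow> real^'s^'n \<Rightarrow> bool" where
  "regular Z L J Y \<longleftrightarrow> (\<forall>d\<in>cbox (-1) 1. \<forall>x z.
     J *v x + Y *v (d * z) = 0 \<and> z = Z *v x + L *v (d * z) \<longrightarrow> x = 0 \<and> z = 0)"

section \<open>Slopes of the componentwise absolute value\<close>

lemma mem_cube: "(d::real^'s) \<in> cbox (-1) 1 \<longleftrightarrow> (\<forall>i. \<bar>d $ i\<bar> \<le> 1)"
  by (auto simp: mem_box_cart abs_le_iff)

lemma abs_vec_nth: "\<bar>z::real^'s\<bar> $ i = \<bar>z $ i\<bar>"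
  by (simp add: abs_vec_def)

lemma abs_diff_eq_slope:
  fixes z1 z2 :: "real^'s"
  obtains d where "d \<in> cbox (-1) 1" "\<bar>z1\<bar> - \<bar>z2\<bar> = d * (z1 - z2)"
proof
  \<comment> \<open>Where the two coordinates agree, division by zero yields slope 0 and both sides
    vanish.\<close>
  let ?d = "\<chi> i. (\<bar>z1 $ i\<bar> - \<bar>z2 $ i\<bar>) / (z1 $ i - z2 $ i)"
  show "?d \<in> cbox (-1) 1"
    by (auto simp: mem_cube abs_divide divide_le_eq_1 abs_triangle_ineq3)
  show "\<bar>z1\<bar> - \<bar>z2\<bar> = ?d * (z1 - z2)"
    by (auto simp: vec_eq_iff abs_vec_nth)
qed

text \<open>Converse of \<open>abs_diff_eq_slope\<close>: it turns a singular triple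
  \<open>(d, x, z)\<close> into two switching vectors that differ by \<open>z\<close>.\<close>

lemma slope_eq_abs_diff:
  fixes d z :: "real^'s"
  assumes "d \<in> cbox (-1) 1"
  obtains z1 z2 where "z1 - z2 = z" "\<bar>z1\<bar> - \<bar>z2\<bar> = d * z"
proof
  \<comment> \<open>In each coordinate the witnesses add up to \<open>k = d * |z|\<close>, with
    \<open>|k| <= |z|\<close>. Hence the first has the sign of \<open>z\<close>, the second weakly
    the opposite sign, and \<open>|z1| - |z2|\<close> is \<open>z1 + z2\<close> times the sign of
    \<open>z\<close>, which is \<open>d * z\<close>.\<close>
  let ?z1 = "\<chi> i. (d $ i * \<bar>z $ i\<bar> + z $ i) / 2"
  let ?z2 = "\<chi> i. (d $ i * \<bar>z $ i\<bar> - z $ i) / 2"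
  show "?z1 - ?z2 = z"
    by (simp add: vec_eq_iff field_simps)
  have *: "\<bar>(k + w) / 2\<bar> - \<bar>(k - w) / 2\<bar> = (if w \<ge> 0 then k else - k)" if "\<bar>k\<bar> \<le> \<bar>w\<bar>" for k w :: real
    using that by (simp add: abs_if field_simps split: if_splits)
  have "\<bar>(e * \<bar>w\<bar> + w) / 2\<bar> - \<bar>(e * \<bar>w\<bar> - w) / 2\<bar> = e * w" if "\<bar>e\<bar> \<le> 1" for e w :: real
    using *[of "e * \<bar>w\<bar>" w] that by (simp add: abs_mult mult_left_le_one_le)
  with assms show "\<bar>?z1\<bar> - \<bar>?z2\<bar> = d * z"
    by (simp add: vec_eq_iff abs_vec_nth mem_cube)
qed

section \<open>Openness of regularity\<close>

lemma norm_matrix_vector_mult_le: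
  fixes A :: "real^'n^'m"
  shows "norm (A *v x) \<le> norm A * norm x"
proof -
  have "norm (A *v x) \<le> L2_set (\<lambda>i. norm (A $ i) * norm x) UNIV"
    unfolding norm_vec_def[of "A *v x"]
    by (rule L2_set_mono) (simp_all add: matrix_vector_mul_component Cauchy_Schwarz_ineq2)
  also have "\<dots> = norm A * norm x"
    by (simp add: norm_vec_def[of A] L2_set_left_distrib)
  finally show ?thesis .
qed

lemma norm_cube_mult_le:
  fixes d z :: "real^'s"
  assumes "d \<in> cbox (-1) 1"
  shows "norm (d * z) \<le> norm z"
  unfolding norm_vec_def
  by (rule L2_set_mono) (use assms in \<open>auto simp: mem_cube abs_mult mult_left_le_one_le\<close>)

text \<open>The residual norm attains its minimum on the compact product of the cube and the unit
  sphere. Regularity makes this minimum positive, and for fixed \<open>d\<close> homogeneity in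
  \<open>(x, z)\<close> extends the bound from the sphere to all vectors.\<close>

lemma regular_bounded_below:
  fixes Z :: "real^'n^'s" and L :: "real^'s^'s" and J :: "real^'n^'n" and Y :: "real^'s^'n"
  assumes "regular Z L J Y"
  obtains \<mu> where "\<mu> > 0"
    "\<And>d x z. d \<in> cbox (-1) 1 \<Longrightarrow>
       \<mu> * norm (x, z) \<le> norm (J *v x + Y *v (d * z), z - Z *v x - L *v (d * z))"
proof -
  define T where "T = (\<lambda>(d::real^'s, x::real^'n, z). (J *v x + Y *v (d * z), z - Z *v x - L *v (d * z)))"
  define K where "K = cbox (-1) (1::real^'s) \<times> sphere (0::(real^'n) \<times> (real^'s)) 1"
  have "compact K" unfolding K_def by (intro compact_Times compact_cbox compact_sphere)
  have ne: "K \<noteq> {}"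
  proof -
    have "(0::real^'s) \<in> cbox (-1) 1" by (simp add: mem_cube)
    moreover have "(axis undefined 1, 0) \<in> sphere (0::(real^'n) \<times> (real^'s)) 1"
      by (simp add: norm_Pair)
    ultimately show ?thesis unfolding K_def by blast
  qed
  have c1: "continuous_on UNIV (\<lambda>p::(real^'s) \<times> (real^'n) \<times> (real^'s). fst p * snd (snd p))"
    unfolding times_vec_def by (intro continuous_intros)
  have lin: "continuous_on UNIV f \<Longrightarrow> continuous_on UNIV (\<lambda>p. A *v f p)"
    for A :: "real^'a^'b" and f :: "(real^'s) \<times> (real^'n) \<times> (real^'s) \<Rightarrow> real^'a"
    by (rule continuous_on_compose2[OF matrix_vector_mult_linear_continuous_on]) auto
  have "continuous_on UNIV (\<lambda>p. norm (T p))"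
    unfolding T_def split_beta by (intro continuous_intros lin c1)
  then have "continuous_on K (\<lambda>p. norm (T p))"
    by (rule continuous_on_subset) simp
  from continuous_attains_inf[OF \<open>compact K\<close> ne this]
  obtain p0 where p0: "p0 \<in> K" "\<And>p. p \<in> K \<Longrightarrow> norm (T p0) \<le> norm (T p)" by blast
  obtain d0 x0 z0 where p0_eq: "p0 = (d0, x0, z0)" by (cases p0) auto
  have "T p0 \<noteq> 0"
  proof
    assume "T p0 = 0"
    then have "J *v x0 + Y *v (d0 * z0) = 0" "z0 = Z *v x0 + L *v (d0 * z0)"
      by (auto simp: T_def p0_eq zero_prod_def algebra_simps)
    moreover have "d0 \<in> cbox (-1) 1" using p0 by (simp add: K_def p0_eq)
    ultimately have "x0 = 0" "z0 = 0"
      using assms unfolding regular_def by blast+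
    then show False using p0 by (simp add: K_def p0_eq norm_Pair)
  qed
  show thesis
  proof (rule that[of "norm (T p0)"])
    show "norm (T p0) > 0" using \<open>T p0 \<noteq> 0\<close> by simp
  next
    fix d :: "real^'s" and x z assume d: "d \<in> cbox (-1) 1"
    show "norm (T p0) * norm (x, z) \<le> norm (J *v x + Y *v (d * z), z - Z *v x - L *v (d * z))"
    proof (cases "(x, z) = 0")
      case False
      define r where "r = norm (x, z)"
      have r: "r > 0" using False by (simp add: r_def)
      have "norm (inverse r *\<^sub>R (x, z)) = 1" unfolding norm_scaleR using r by (simp add: r_def[symmetric])
      then have "(d, inverse r *\<^sub>R (x, z)) \<in> K" using d by (simp add: K_def)
      from p0(2)[OF this] have "norm (T p0) \<le> norm (inverse r *\<^sub>R T (d, x, z))"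
        by (simp add: T_def matrix_vector_mult_scaleR scaleR_right_distrib scaleR_diff_right)
      then have "norm (T p0) \<le> inverse r * norm (T (d, x, z))" using r by simp
      then have "norm (T p0) * r \<le> norm (T (d, x, z))" using r by (simp add: field_simps)
      then show ?thesis by (simp add: T_def r_def)
    qed (simp add: zero_prod_def)
  qed
qed

lemma regular_stable:
  fixes Z :: "real^'n^'s" and L :: "real^'s^'s" and J :: "real^'n^'n" and Y :: "real^'s^'n"
  assumes "regular Z L J Y"
  obtains \<epsilon> where "\<epsilon> > 0"
    "\<And>Z' L' J' Y'. norm (Z' - Z) < \<epsilon> \<Longrightarrow> norm (L' - L) < \<epsilon> \<Longrightarrow> norm (J' - J) < \<epsilon> \<Longrightarrow>
       norm (Y' - Y) < \<epsilon> \<Longrightarrow> regular Z' L' J' Y'"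
proof -
  obtain \<mu> where \<mu>: "\<mu> > 0" "\<And>d x z. d \<in> cbox (-1) 1 \<Longrightarrow>
       \<mu> * norm (x, z) \<le> norm (J *v x + Y *v (d * z), z - Z *v x - L *v (d * z))"
    using regular_bounded_below[OF assms] by metis
  show thesis
  \<comment> \<open>Four perturbed matrices contribute at most \<open>norm (x, z) / 8\<close> times
    the lower bound each, so half of the bound remains.\<close>
  proof (rule that[of "\<mu> / 8"])
    show "\<mu> / 8 > 0" using \<mu> by simp
  next
    fix Z' L' J' Y'
    assume *: "norm (Z' - Z) < \<mu> / 8" "norm (L' - L) < \<mu> / 8" "norm (J' - J) < \<mu> / 8"
      "norm (Y' - Y) < \<mu> / 8"
    have small: "norm ((A' - A) *v w) \<le> \<mu> / 8 * norm (x, z)"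
      if "norm (A' - A) < \<mu> / 8" "norm w \<le> norm (x, z)"
      for A' A :: "real^'a^'b" and w and x :: "real^'n" and z :: "real^'s"
      using norm_matrix_vector_mult_le[of "A' - A" w] that
      by (meson less_imp_le mult_mono' norm_ge_zero order_trans)
    show "regular Z' L' J' Y'"
      unfolding regular_def
    proof (intro ballI allI impI)
      fix d :: "real^'s" and x z
      assume d: "d \<in> cbox (-1) 1"
        and eq: "J' *v x + Y' *v (d * z) = 0 \<and> z = Z' *v x + L' *v (d * z)"
      have x: "norm x \<le> norm (x, z)" using norm_fst_le[of x z] by simp
      have z: "norm (d * z) \<le> norm (x, z)"
        using norm_cube_mult_le[OF d, of z] norm_snd_le[of z x] by simp
      have "J *v x + Y *v (d * z) = - ((J' - J) *v x + (Y' - Y) *v (d * z))"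
        using eq by (simp add: matrix_vector_mult_diff_rdistrib algebra_simps)
      moreover have "z - Z *v x - L *v (d * z) = (Z' - Z) *v x + (L' - L) *v (d * z)"
        using eq by (simp add: matrix_vector_mult_diff_rdistrib)
      ultimately have "norm (J *v x + Y *v (d * z), z - Z *v x - L *v (d * z))
        \<le> norm ((J' - J) *v x + (Y' - Y) *v (d * z)) + norm ((Z' - Z) *v x + (L' - L) *v (d * z))"
        using norm_Pair_le by (metis norm_minus_cancel)
      also have "\<dots> \<le> (norm ((J' - J) *v x) + norm ((Y' - Y) *v (d * z)))
          + (norm ((Z' - Z) *v x) + norm ((L' - L) *v (d * z)))"
        by (intro add_mono norm_triangle_ineq)
      also have "\<dots> \<le> (\<mu> / 8 * norm (x, z) + \<mu> / 8 * norm (x, z))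
          + (\<mu> / 8 * norm (x, z) + \<mu> / 8 * norm (x, z))"
        by (intro add_mono small * x z)
      finally have "\<mu> * norm (x, z) \<le> \<mu> / 2 * norm (x, z)"
        using \<mu>(2)[OF d, of x z] by simp
      then have "norm (x, z) \<le> 0" using \<mu>(1) by (simp add: field_simps)
      then show "x = 0 \<and> z = 0" by (simp add: zero_prod_def)
    qed
  qed
qed

section \<open>Unique solvability and the absolute value equation\<close>

text \<open>The map \<open>G\<close> expands distances by a fixed positive factor. It is therefore
  injective, so its range is open by invariance of domain; Cauchy sequences of values pull back to
  Cauchy sequences of arguments, so the range is also closed. Connectedness gives
  surjectivity.\<close>

lemma regular_ex1:
  fixes Z :: "real^'n^'s" and L :: "real^'s^'s" and J :: "real^'n^'n" and Y :: "real^'s^'n"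
  assumes "regular Z L J Y"
  shows "\<exists>!(x, z). J *v x + Y *v \<bar>z\<bar> = p \<and> z = q + Z *v x + L *v \<bar>z\<bar>"
proof -
  define G where "G = (\<lambda>(x, z). (J *v x + Y *v \<bar>z\<bar>, z - Z *v x - L *v \<bar>z\<bar>))"
  obtain \<mu> where \<mu>: "\<mu> > 0" "\<And>d x z. d \<in> cbox (-1) 1 \<Longrightarrow>
       \<mu> * norm (x, z) \<le> norm (J *v x + Y *v (d * z), z - Z *v x - L *v (d * z))"
    using regular_bounded_below[OF assms] by metis
  have expand: "\<mu> * norm (v - w) \<le> norm (G v - G w)" for v w
  proof -
    obtain x1 z1 x2 z2 where vw: "v = (x1, z1)" "w = (x2, z2)" by (metis surj_pair)
    \<comment> \<open>With this slope the difference of two values of \<open>G\<close> becomes the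
      linear residual at the difference of the arguments.\<close>
    obtain d where d: "d \<in> cbox (-1) 1" "\<bar>z1\<bar> - \<bar>z2\<bar> = d * (z1 - z2)"
      by (rule abs_diff_eq_slope)
    have "G v - G w = (J *v (x1 - x2) + Y *v (d * (z1 - z2)),
        (z1 - z2) - Z *v (x1 - x2) - L *v (d * (z1 - z2)))"
      unfolding d(2)[symmetric] vw G_def by (simp add: matrix_vector_mult_diff_distrib)
    then show ?thesis using \<mu>(2)[OF d(1), of "x1 - x2" "z1 - z2"] by (simp add: vw)
  qed
  have inj: "inj G"
  proof (rule injI)
    fix v w assume "G v = G w"
    then have "\<mu> * norm (v - w) \<le> 0" using expand[of v w] by simp
    then show "v = w" using \<mu>(1) by (simp add: mult_le_0_iff)
  qed
  have cabs: "continuous_on UNIV (\<lambda>p::(real^'n) \<times> (real^'s). \<bar>snd p\<bar>)"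
    unfolding abs_vec_def by (intro continuous_intros)
  have lin: "continuous_on UNIV f \<Longrightarrow> continuous_on UNIV (\<lambda>p. A *v f p)"
    for A :: "real^'a^'b" and f :: "(real^'n) \<times> (real^'s) \<Rightarrow> real^'a"
    by (rule continuous_on_compose2[OF matrix_vector_mult_linear_continuous_on]) auto
  have cont: "continuous_on UNIV G"
    unfolding G_def split_beta by (intro continuous_intros lin cabs)
  have "open (range G)"
    by (rule invariance_of_domain[OF cont open_UNIV inj])
  moreover have "complete (range G)"
    unfolding complete_def
  proof (intro allI impI)
    fix f assume f: "(\<forall>n. f n \<in> range G) \<and> Cauchy f"
    then have "\<forall>n::nat. \<exists>v. f n = G v" by blast
    then obtain h where h: "\<And>n. f n = G (h n)" by metis
    have "Cauchy h"
      unfolding Cauchy_def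
    proof (intro allI impI)
      fix e :: real assume "e > 0"
      then have "\<mu> * e > 0" using \<mu> by simp
      with f obtain M where M: "\<And>m n. m \<ge> M \<Longrightarrow> n \<ge> M \<Longrightarrow> dist (f m) (f n) < \<mu> * e"
        unfolding Cauchy_def by blast
      have "dist (h m) (h n) < e" if "m \<ge> M" "n \<ge> M" for m n
      proof -
        have "\<mu> * dist (h m) (h n) < \<mu> * e"
          using expand[of "h m" "h n"] M[OF that] by (simp add: dist_norm h)
        then show ?thesis using \<mu> by simp
      qed
      then show "\<exists>M. \<forall>m\<ge>M. \<forall>n\<ge>M. dist (h m) (h n) < e" by blast
    qed
    then obtain l where "h \<longlonglongrightarrow> l" by (metis Cauchy_convergent_iff convergent_def)
    moreover have "isCont G l" using cont by (metis UNIV_I continuous_on_eq_continuous_at open_UNIV)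
    ultimately have "(\<lambda>n. G (h n)) \<longlonglongrightarrow> G l" by (rule isCont_tendsto_compose[rotated])
    then show "\<exists>l\<in>range G. f \<longlonglongrightarrow> l" unfolding h[symmetric] by blast
  qed
  then have "closed (range G)" by (rule complete_imp_closed)
  ultimately have surj: "range G = UNIV"
    using clopen[of "range G"] by blast
  have eq: "J *v x + Y *v \<bar>z\<bar> = p \<and> z = q + Z *v x + L *v \<bar>z\<bar> \<longleftrightarrow> G (x, z) = (p, q)" for x z
    by (auto simp: G_def algebra_simps)
  obtain v where v: "G v = (p, q)" using surj by (metis rangeE UNIV_I)
  show ?thesis
    unfolding eq
  proof (rule ex1I[of _ v])
    show "case v of (x, z) \<Rightarrow> G (x, z) = (p, q)" using v by (simp add: split_beta)
    fix w assume "case w of (x, z) \<Rightarrow> G (x, z) = (p, q)"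
    then have "G w = G v" using v by (simp add: split_beta)
    then show "w = v" using inj by (simp add: inj_eq)
  qed
qed

lemma matrix_inv_mult:
  fixes A :: "real^'n^'n"
  assumes "invertible A"
  shows "A ** matrix_inv A = mat 1" "matrix_inv A ** A = mat 1"
  using someI_ex[OF assms[unfolded invertible_def]] by (auto simp: matrix_inv_def)

lemma matrix_inv_vector_eq_iff:
  fixes A :: "real^'n^'n"
  assumes "invertible A"
  shows "x = matrix_inv A *v y \<longleftrightarrow> A *v x = y"
  using matrix_inv_mult[OF assms] by (metis matrix_vector_mul_assoc matrix_vector_mul_lid)

text \<open>Solving the first equation for \<open>x\<close> by means of \<open>J\<close> leaves an
  equation in \<open>z\<close> with the matrix of the absolute value equation. Regularity solves it
  through \<open>regular_ex1\<close> with right-hand side \<open>(0, c)\<close>; conversely,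
  \<open>slope_eq_abs_diff\<close> splits a singular \<open>z\<close> into two solutions of one such
  equation.\<close>

lemma regular_iff_ave:
  fixes Z :: "real^'n^('s::{finite,wellorder})" and Y :: "real^('s::{finite,wellorder})^'n"
  assumes J: "invertible J"
  shows "regular Z L J Y \<longleftrightarrow> ave_uniquely_solvable (L - Z ** matrix_inv J ** Y)"
proof -
  have Jx: "J *v x + v = 0 \<longleftrightarrow> x = - (matrix_inv J *v v)" for x v
  proof -
    have "J *v x + v = 0 \<longleftrightarrow> J *v (- x) = v"
      by (metis add_eq_0_iff mult_minus_right neg_equal_iff_equal vec.neg)
    also have "\<dots> \<longleftrightarrow> - x = matrix_inv J *v v"
      by (simp add: matrix_inv_vector_eq_iff[OF J])
    finally show ?thesis by (metis minus_minus)
  qed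
  have S: "(L - Z ** matrix_inv J ** Y) *v v = Z *v (- (matrix_inv J *v (Y *v v))) + L *v v" for v
    by (simp add: matrix_vector_mult_diff_rdistrib matrix_vector_mul_assoc[symmetric] vec.neg)
  show ?thesis
  proof
    assume reg: "regular Z L J Y"
    show "ave_uniquely_solvable (L - Z ** matrix_inv J ** Y)"
      unfolding ave_uniquely_solvable_def
    proof
      fix c
      have eq: "J *v x + Y *v \<bar>z\<bar> = 0 \<and> z = c + Z *v x + L *v \<bar>z\<bar> \<longleftrightarrow>
        x = - (matrix_inv J *v (Y *v \<bar>z\<bar>)) \<and> z - (L - Z ** matrix_inv J ** Y) *v \<bar>z\<bar> = c" for x z
        unfolding Jx S by (auto simp: algebra_simps)
      show "\<exists>!z. z - (L - Z ** matrix_inv J ** Y) *v \<bar>z\<bar> = c"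
        using regular_ex1[OF reg, of 0 c] unfolding eq by (auto simp: Ex1_def)
    qed
  next
    assume ave: "ave_uniquely_solvable (L - Z ** matrix_inv J ** Y)"
    show "regular Z L J Y"
      unfolding regular_def
    proof (intro ballI allI impI)
      fix d x z
      assume d: "d \<in> cbox (-1) 1"
        and eq: "J *v x + Y *v (d * z) = 0 \<and> z = Z *v x + L *v (d * z)"
      have x: "x = - (matrix_inv J *v (Y *v (d * z)))" using eq by (simp add: Jx)
      have z: "z = (L - Z ** matrix_inv J ** Y) *v (d * z)"
        unfolding S using eq by (simp add: x[symmetric])
      obtain z1 z2 where zz: "z1 - z2 = z" "\<bar>z1\<bar> - \<bar>z2\<bar> = d * z"
        using slope_eq_abs_diff[OF d] by metis
      have "z1 - z2 = (L - Z ** matrix_inv J ** Y) *v (\<bar>z1\<bar> - \<bar>z2\<bar>)"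
        using z zz by simp
      then have "z1 - (L - Z ** matrix_inv J ** Y) *v \<bar>z1\<bar> = z2 - (L - Z ** matrix_inv J ** Y) *v \<bar>z2\<bar>"
        by (simp add: matrix_vector_mult_diff_distrib algebra_simps)
      then have "z1 = z2" using ave unfolding ave_uniquely_solvable_def by metis
      then have "z = 0" using zz by simp
      with x show "x = 0 \<and> z = 0" by simp
    qed
  qed
qed

section \<open>Regularity and bijectivity\<close>

lemma anf_switching_eqI:
  assumes "strictly_lower_triangular L" "z = c + Z *v x + L *v \<bar>z\<bar>"
  shows "anf_switching c Z L x = z"
  unfolding anf_switching_def
  by (rule the1_equality[OF anf_switching_ex1[OF assms(1)] assms(2)])

text \<open>Solving for a preimage of \<open>y\<close> is the system of \<open>regular_ex1\<close>
  with right-hand side \<open>(y - b, c)\<close>: its second equation forces \<open>z\<close> to be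
  the switching vector at \<open>x\<close>.\<close>

lemma regular_imp_bij:
  assumes L: "strictly_lower_triangular L" and reg: "regular Z L J Y"
  shows "bij (anf_fun c b Z L J Y)"
proof (rule bijI)
  let ?z = "anf_switching c Z L"
  have sol: "J *v x + Y *v \<bar>?z x\<bar> = anf_fun c b Z L J Y x - b \<and> ?z x = c + Z *v x + L *v \<bar>?z x\<bar>" for x
    using anf_switching_eq[OF L, of c Z x] by (simp add: anf_fun_def)
  show "inj (anf_fun c b Z L J Y)"
  proof (rule injI)
    fix x1 x2 assume "anf_fun c b Z L J Y x1 = anf_fun c b Z L J Y x2"
    then have "(x1, ?z x1) = (x2, ?z x2)"
      using regular_ex1[OF reg, of "anf_fun c b Z L J Y x2 - b" c] sol[of x1] sol[of x2] by auto
    then show "x1 = x2" by simp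
  qed
  show "surj (anf_fun c b Z L J Y)"
    unfolding surj_def
  proof
    fix y
    obtain x z where xz: "J *v x + Y *v \<bar>z\<bar> = y - b" "z = c + Z *v x + L *v \<bar>z\<bar>"
      using regular_ex1[OF reg, of "y - b" c] by auto
    have "anf_fun c b Z L J Y x = y"
      using xz(1) anf_switching_eqI[OF L xz(2)] by (simp add: anf_fun_def add.assoc)
    then show "\<exists>x. y = anf_fun c b Z L J Y x" by blast
  qed
qed

text \<open>A singular triple yields two points with the same value: surjectivity of
  \<open>Z\<close> realizes \<open>z1\<close> as the switching vector at some \<open>x1\<close>, and
  then \<open>z2\<close> is the switching vector at \<open>x1 - x\<close>.\<close>

lemma surj_inj_imp_regular:
  assumes L: "strictly_lower_triangular L" and Z: "surj ((*v) Z)"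
    and inj: "inj (anf_fun c b Z L J Y)"
  shows "regular Z L J Y"
  unfolding regular_def
proof (intro ballI allI impI)
  fix d x z
  assume d: "d \<in> cbox (-1) 1"
    and eq: "J *v x + Y *v (d * z) = 0 \<and> z = Z *v x + L *v (d * z)"
  obtain z1 z2 where zz: "z1 - z2 = z" "\<bar>z1\<bar> - \<bar>z2\<bar> = d * z"
    using slope_eq_abs_diff[OF d] by metis
  obtain x1 where x1: "Z *v x1 = z1 - L *v \<bar>z1\<bar> - c" using Z by (metis surjD)
  define x2 where "x2 = x1 - x"
  have "z1 - z2 = Z *v x + L *v (\<bar>z1\<bar> - \<bar>z2\<bar>)" using eq zz by simp
  then have "z2 = c + Z *v x2 + L *v \<bar>z2\<bar>"
    unfolding x2_def matrix_vector_mult_diff_distrib x1 by (simp add: algebra_simps)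
  then have s2: "anf_switching c Z L x2 = z2" by (rule anf_switching_eqI[OF L])
  have s1: "anf_switching c Z L x1 = z1" by (rule anf_switching_eqI[OF L]) (simp add: x1)
  have "J *v x + Y *v (\<bar>z1\<bar> - \<bar>z2\<bar>) = 0" using eq zz by simp
  then have "anf_fun c b Z L J Y x1 = anf_fun c b Z L J Y x2"
    unfolding anf_fun_def s1 s2 unfolding x2_def matrix_vector_mult_diff_distrib
    by (simp add: algebra_simps)
  then have "x1 = x2" using inj by (simp add: inj_eq)
  then show "x = 0 \<and> z = 0" using s1 s2 zz by (simp add: x2_def)
qed


section \<open>Triangular systems and Jacobians of the pieces\<close>

text \<open>Forward substitution: row \<open>j\<close> of \<open>L\<close> involves only earlier
  entries of \<open>z\<close>, which vanish by induction.\<close>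

lemma triangular_zero_upto:
  fixes L :: "real^('s::{finite,wellorder})^('s::{finite,wellorder})"
  assumes L: "strictly_lower_triangular L" and v: "\<And>j. j \<le> i \<Longrightarrow> v $ j = 0"
    and z: "z = v + L *v (d * z)" and "j \<le> i"
  shows "z $ j = 0"
  using \<open>j \<le> i\<close>
proof (induction j rule: less_induct)
  case (less j)
  have "L $ j $ k * (d * z) $ k = 0" for k
    using L less by (cases "j \<le> k") (auto simp: strictly_lower_triangular_def)
  then have "(L *v (d * z)) $ j = 0"
    by (simp only: matrix_vector_mult_def vec_lambda_beta sum.neutral_const)
  then show ?case
    using v[OF less.prems] arg_cong[OF z, of "\<lambda>v. v $ j"] by simp
qed

lemma triangular_eq_0:
  fixes L :: "real^('s::{finite,wellorder})^('s::{finite,wellorder})"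
  assumes "strictly_lower_triangular L" "z = L *v (d * z)"
  shows "z = 0"
proof -
  have "z $ i = 0" for i
    using triangular_zero_upto[OF assms(1), of i 0 z d i] assms(2) by simp
  then show ?thesis by (simp add: vec_eq_iff)
qed

definition scale_cols :: "real^'s^'m \<Rightarrow> real^'s \<Rightarrow> real^'s^'m" where
  "scale_cols A d = (\<chi> i j. A $ i $ j * d $ j)"

lemma scale_cols_mult: "scale_cols A d *v z = A *v (d * z)"
  by (simp add: scale_cols_def matrix_vector_mult_def mult.assoc)

text \<open>\<open>switch_inv L d *v v\<close> is the switching vector at \<open>c + Z x = v\<close> when \<open>\<bar>z\<bar> = d * z\<close>.\<close>
definition switch_inv :: "real^'s^'s \<Rightarrow> real^'s \<Rightarrow> real^'s^'s" where
  "switch_inv L d = matrix_inv (mat 1 - scale_cols L d)"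

text \<open>The matrix \<open>I - L D\<close> is unit lower triangular, hence invertible for every
  diagonal \<open>D\<close>, inside the cube or not.\<close>

lemma switch_inv_eq_iff:
  fixes L :: "real^('s::{finite,wellorder})^('s::{finite,wellorder})"
  assumes "strictly_lower_triangular L"
  shows "z = switch_inv L d *v v \<longleftrightarrow> z = v + L *v (d * z)"
proof -
  have mv: "(mat 1 - scale_cols L d) *v w = w - L *v (d * w)" for w
    by (simp add: matrix_vector_mult_diff_rdistrib scale_cols_mult)
  have "invertible (mat 1 - scale_cols L d)"
    unfolding invertible_left_inverse matrix_left_invertible_ker mv
    using triangular_eq_0[OF assms] by auto
  then show ?thesis
    unfolding switch_inv_def matrix_inv_vector_eq_iff[OF \<open>invertible _\<close>] mv
    by (auto simp: algebra_simps)
qed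

text \<open>This is \<open>J + Y D (I - L D)^(-1) Z\<close>, the Schur complement left after
  eliminating \<open>z\<close> from the linear system with \<open>D\<close> in place of the absolute
  value.\<close>

definition piece_matrix ::
  "real^'n^'s \<Rightarrow> real^'s^'s \<Rightarrow> real^'n^'n \<Rightarrow> real^'s^'n \<Rightarrow> real^'s \<Rightarrow> real^'n^'n" where
  "piece_matrix Z L J Y d = J + scale_cols Y d ** switch_inv L d ** Z"

lemma piece_matrix_mult:
  "piece_matrix Z L J Y d *v x = J *v x + Y *v (d * (switch_inv L d *v (Z *v x)))"
  by (simp add: piece_matrix_def matrix_vector_mult_add_rdistrib scale_cols_mult
      matrix_vector_mul_assoc[symmetric])

text \<open>For fixed \<open>d\<close> the second equation determines \<open>z\<close> from
  \<open>x\<close>, so the solutions of the homogeneous system correspond to the kernel of the piece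
  matrix.\<close>

lemma regular_iff_piece_matrix:
  assumes L: "strictly_lower_triangular L"
  shows "regular Z L J Y \<longleftrightarrow> (\<forall>d\<in>cbox (-1) 1. det (piece_matrix Z L J Y d) \<noteq> 0)"
proof -
  have "det (piece_matrix Z L J Y d) \<noteq> 0 \<longleftrightarrow>
    (\<forall>x z. J *v x + Y *v (d * z) = 0 \<and> z = Z *v x + L *v (d * z) \<longrightarrow> x = 0 \<and> z = 0)" for d
  proof -
    have "det (piece_matrix Z L J Y d) \<noteq> 0 \<longleftrightarrow> (\<forall>x. piece_matrix Z L J Y d *v x = 0 \<longrightarrow> x = 0)"
      by (simp add: invertible_det_nz[symmetric] invertible_left_inverse matrix_left_invertible_ker)
    then show ?thesis
      unfolding switch_inv_eq_iff[OF L, symmetric] piece_matrix_mult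
      by (metis matrix_vector_mult_0_right)
  qed
  then show ?thesis unfolding regular_def by blast
qed

section \<open>Determinants of the pieces over the cube\<close>

text \<open>An orthogonal map takes \<open>u\<close> to a multiple of one axis. After multiplication
  by its matrix the rank one term affects a single row, in which the determinant is linear.\<close>

lemma det_rank_one_affine:
  fixes A :: "real^'n^'n" and u r :: "real^'n"
  shows "\<exists>\<alpha> \<beta>. \<forall>t. det (A + t *\<^sub>R (\<chi> i j. u $ i * r $ j)) = \<alpha> + \<beta> * t"
proof -
  define k :: 'n where "k = undefined"
  have "norm u = norm (norm u *\<^sub>R (axis k 1 :: real^'n))" by simp
  from orthogonal_transformation_exists[OF this]
  obtain f where f: "orthogonal_transformation f" "f u = norm u *\<^sub>R (axis k 1 :: real^'n)" .
  have lin: "linear f" using f(1) by (rule orthogonal_transformation_linear)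
  define P where "P = matrix f"
  have Pu: "P *v u = norm u *\<^sub>R axis k 1" using f(2) lin by (simp add: P_def matrix_works)
  have P: "det P \<noteq> 0"
    using f(1) det_orthogonal_matrix[of P] by (auto simp: P_def orthogonal_transformation_matrix)
  have rows: "P ** (A + t *\<^sub>R (\<chi> i j. u $ i * r $ j))
      = (\<chi> i. if i = k then (P ** A) $ k + t *s (norm u *s r) else (P ** A) $ i)" for t
  proof -
    have "(P ** (\<chi> i j. u $ i * r $ j)) $ i $ j = (P *v u) $ i * r $ j" for i j
      by (simp add: matrix_matrix_mult_def matrix_vector_mult_def sum_distrib_right mult.assoc)
    then have "(P ** (\<chi> i j. u $ i * r $ j)) $ i $ j = (if i = k then norm u * r $ j else 0)" for i j
      unfolding Pu by (simp add: axis_def)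
    moreover have "P ** (A + t *\<^sub>R B) = P ** A + t *\<^sub>R (P ** B)" for B
      by (simp add: vec_eq_iff matrix_matrix_mult_def algebra_simps sum.distrib sum_distrib_left)
    ultimately show ?thesis by (simp add: vec_eq_iff)
  qed
  have "det P * det (A + t *\<^sub>R (\<chi> i j. u $ i * r $ j))
      = det (\<chi> i. if i = k then (P ** A) $ k else (P ** A) $ i)
        + t * det (\<chi> i. if i = k then norm u *s r else (P ** A) $ i)" for t
    unfolding det_mul[symmetric] rows det_row_add det_row_mul ..
  then have "det (A + t *\<^sub>R (\<chi> i j. u $ i * r $ j))
      = det (\<chi> i. if i = k then (P ** A) $ k else (P ** A) $ i) / det P
        + det (\<chi> i. if i = k then norm u *s r else (P ** A) $ i) / det P * t" for t
    using P by (simp add: field_simps)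
  then show ?thesis by blast
qed

definition upd :: "real^'s \<Rightarrow> 's \<Rightarrow> real \<Rightarrow> real^'s" where
  "upd d i t = (\<chi> j. if j = i then t else d $ j)"

lemma upd_nth: "upd d i t $ j = (if j = i then t else d $ j)"
  by (simp add: upd_def)

lemma upd_same [simp]: "upd d i (d $ i) = d"
  by (simp add: vec_eq_iff upd_nth)

lemma det_piece_matrix_affine:
  fixes L :: "real^('s::{finite,wellorder})^('s::{finite,wellorder})"
  assumes L: "strictly_lower_triangular L"
  shows "\<exists>\<alpha> \<beta>. \<forall>t. det (piece_matrix Z L J Y (upd d i t)) = \<alpha> + \<beta> * t"
proof -
  define d0 where "d0 = upd d i 0"
  \<comment> \<open>Changing entry \<open>i\<close> of \<open>d\<close> changes the matrix by a multiple of the rank one matrix \<open>u r\<^sup>T\<close>: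
    by triangularity the \<open>i\<close>-th switching variable \<open>r \<bullet> x\<close> itself does not depend on \<open>d $ i\<close>.\<close>
  have upd: "upd d i t * w = d0 * w + (t * w $ i) *\<^sub>R axis i 1" for t w
    by (auto simp: vec_eq_iff d0_def upd_nth axis_def)
  \<comment> \<open>\<open>g\<close> is the response of the switching vector to a unit change of the
    \<open>i\<close>-th absolute value, and \<open>u\<close> the resulting response of the
    output.\<close>
  define g where "g = switch_inv L d0 *v (L *v axis i 1)"
  define u where "u = Y *v axis i 1 + Y *v (d0 * g)"
  define r where "r = (switch_inv L d0 ** Z) $ i"
  have g: "g = L *v axis i 1 + L *v (d0 * g)"
    using switch_inv_eq_iff[OF L] g_def by blast
  \<comment> \<open>Column \<open>i\<close> of \<open>L\<close> starts below the diagonal, so the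
    response \<open>g\<close> leaves entry \<open>i\<close> of the switching vector
    unchanged.\<close>
  have "(L *v axis i 1) $ j = 0" if "j \<le> i" for j
    using L that by (simp add: matrix_vector_mul_component inner_axis strictly_lower_triangular_def)
  then have gi: "g $ i = 0"
    using triangular_zero_upto[OF L _ g, of i i] by simp
  have "piece_matrix Z L J Y (upd d i t) = piece_matrix Z L J Y d0 + t *\<^sub>R (\<chi> i j. u $ i * r $ j)" for t
  proof -
    have "piece_matrix Z L J Y (upd d i t) *v x
        = (piece_matrix Z L J Y d0 + t *\<^sub>R (\<chi> i j. u $ i * r $ j)) *v x" for x
    proof -
      define z where "z = switch_inv L d0 *v (Z *v x)"
      have zi: "z $ i = r \<bullet> x"
        by (simp add: z_def r_def matrix_vector_mul_assoc matrix_vector_mul_component)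
      \<comment> \<open>The candidate for the switching vector after entry \<open>i\<close> of
        \<open>d\<close> is set to \<open>t\<close>; it is confirmed by checking its fixed point
        equation.\<close>
      define z' where "z' = z + (t * z $ i) *\<^sub>R g"
      have z: "z = Z *v x + L *v (d0 * z)"
        using switch_inv_eq_iff[OF L] z_def by blast
      have Dz': "upd d i t * z' = d0 * z + (t * z $ i) *\<^sub>R (d0 * g) + (t * z $ i) *\<^sub>R axis i 1"
        unfolding upd z'_def by (simp add: gi distrib_left)
      have "L *v (upd d i t * z') = L *v (d0 * z) + (t * z $ i) *\<^sub>R (L *v (d0 * g) + L *v axis i 1)"
        unfolding Dz' by (simp add: matrix_vector_right_distrib matrix_vector_mult_scaleR scaleR_right_distrib)
      also have "\<dots> = L *v (d0 * z) + (t * z $ i) *\<^sub>R g"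
        using g by (simp add: add.commute)
      finally have "z' = Z *v x + L *v (upd d i t * z')"
        unfolding z'_def using z by (metis add.assoc)
      then have z'_eq: "z' = switch_inv L (upd d i t) *v (Z *v x)"
        using switch_inv_eq_iff[OF L] by blast
      have "piece_matrix Z L J Y (upd d i t) *v x = J *v x + Y *v (upd d i t * z')"
        by (simp add: piece_matrix_mult z'_eq)
      also have "\<dots> = J *v x + Y *v (d0 * z) + (t * z $ i) *\<^sub>R u"
        unfolding Dz' u_def
        by (simp add: matrix_vector_right_distrib matrix_vector_mult_scaleR scaleR_right_distrib)
      also have "(t * z $ i) *\<^sub>R u = (t *\<^sub>R (\<chi> i j. u $ i * r $ j)) *v x"
        by (simp add: zi vec_eq_iff matrix_vector_mult_def inner_vec_def sum_distrib_left sum_distrib_right mult_ac)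
      also have "J *v x + Y *v (d0 * z) = piece_matrix Z L J Y d0 *v x"
        by (simp add: piece_matrix_mult z_def)
      finally show ?thesis by (simp add: matrix_vector_mult_add_rdistrib)
    qed
    then show ?thesis by (simp add: matrix_eq)
  qed
  then show ?thesis using det_rank_one_affine[of "piece_matrix Z L J Y d0" u r] by simp
qed

lemma affine_pos_between:
  fixes \<alpha> \<beta> \<sigma> t :: real
  assumes "\<sigma> * (\<alpha> + \<beta> * 1) > 0" "\<sigma> * (\<alpha> + \<beta> * - 1) > 0" "\<bar>t\<bar> \<le> 1"
  shows "\<sigma> * (\<alpha> + \<beta> * t) > 0"
proof -
  have "\<bar>\<sigma> * \<beta>\<bar> < \<sigma> * \<alpha>" using assms by (auto simp: algebra_simps)
  moreover have "\<bar>\<sigma> * \<beta> * t\<bar> \<le> \<bar>\<sigma> * \<beta>\<bar>"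
    unfolding abs_mult[of "\<sigma> * \<beta>"] using assms(3) by (simp add: mult_left_le)
  ultimately show ?thesis by (auto simp: algebra_simps)
qed

text \<open>The root lies outside \<open>[-1, 1]\<close>, so the constant term dominates the linear
  one.\<close>

lemma affine_sgn_eq:
  fixes \<alpha> \<beta> t :: real
  assumes nz: "\<And>t. \<bar>t\<bar> \<le> 1 \<Longrightarrow> \<alpha> + \<beta> * t \<noteq> 0" and t: "\<bar>t\<bar> \<le> 1"
  shows "sgn (\<alpha> + \<beta> * t) = sgn \<alpha>"
proof -
  have \<alpha>: "\<alpha> \<noteq> 0" using nz[of 0] by simp
  have "\<bar>\<beta>\<bar> < \<bar>\<alpha>\<bar>"
  proof (rule ccontr)
    assume "\<not> \<bar>\<beta>\<bar> < \<bar>\<alpha>\<bar>"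
    then have "\<beta> \<noteq> 0" "\<bar>- \<alpha> / \<beta>\<bar> \<le> 1" using \<alpha> by (auto simp: abs_divide divide_le_eq_1)
    then show False using nz[of "- \<alpha> / \<beta>"] by simp
  qed
  moreover have "\<bar>\<beta> * t\<bar> \<le> \<bar>\<beta>\<bar>"
    using t by (simp add: abs_mult mult_left_le)
  ultimately show ?thesis by (auto simp: sgn_if)
qed

text \<open>Induction on the set of coordinates that may differ from -1 and 1: one such coordinate
  is moved to both endpoints, and affinity in that coordinate interpolates the sign.\<close>

lemma det_piece_matrix_vertices:
  fixes L :: "real^('s::{finite,wellorder})^('s::{finite,wellorder})"
  assumes L: "strictly_lower_triangular L"
    and vert: "\<And>d. \<forall>i. d $ i \<in> {-1, 1} \<Longrightarrow> \<sigma> * det (piece_matrix Z L J Y d) > 0"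
    and d: "d \<in> cbox (-1) 1"
  shows "\<sigma> * det (piece_matrix Z L J Y d) > 0"
proof -
  have "\<sigma> * det (piece_matrix Z L J Y d) > 0"
    if "finite T" "\<forall>i\<in>T. \<bar>d $ i\<bar> \<le> 1" "\<forall>i. i \<notin> T \<longrightarrow> d $ i \<in> {-1, 1}" for T d
    using that
  proof (induction T arbitrary: d rule: finite_induct)
    case empty
    then show ?case by (intro vert) auto
  next
    case (insert i T)
    obtain \<alpha> \<beta> where aff: "\<And>t. det (piece_matrix Z L J Y (upd d i t)) = \<alpha> + \<beta> * t"
      using det_piece_matrix_affine[OF L] by metis
    have pos: "\<sigma> * (\<alpha> + \<beta> * t) > 0" if "t \<in> {-1, 1}" for t
      unfolding aff[symmetric] using insert.prems insert.hyps that
      by (intro insert.IH) (auto simp: upd_nth)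
    have "\<sigma> * (\<alpha> + \<beta> * d $ i) > 0"
      by (rule affine_pos_between[OF pos pos]) (use insert.prems in simp_all)
    then show ?case using aff[of "d $ i"] by simp
  qed
  from this[of UNIV] show ?thesis using d by (simp add: mem_cube)
qed

lemma piece_matrix_0: "piece_matrix Z L J Y 0 = J"
proof -
  have "scale_cols Y 0 = 0" by (simp add: scale_cols_def vec_eq_iff)
  then show ?thesis by (simp add: piece_matrix_def)
qed

text \<open>The coordinates of \<open>d\<close> are set to 0 one at a time. Along each move the
  determinant is affine without a zero, so its sign persists down to \<open>d = 0\<close>, where the
  piece matrix is \<open>J\<close>.\<close>

lemma regular_det_sgn:
  fixes L :: "real^('s::{finite,wellorder})^('s::{finite,wellorder})"
  assumes L: "strictly_lower_triangular L" and reg: "regular Z L J Y"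
    and d: "d \<in> cbox (-1) 1"
  shows "sgn (det (piece_matrix Z L J Y d)) = sgn (det J)"
proof -
  have nz: "det (piece_matrix Z L J Y d) \<noteq> 0" if "\<forall>i. \<bar>d $ i\<bar> \<le> 1" for d
    using reg that unfolding regular_iff_piece_matrix[OF L] by (simp add: mem_cube)
  have "sgn (det (piece_matrix Z L J Y d)) = sgn (det J)"
    if "finite T" "\<forall>i. \<bar>d $ i\<bar> \<le> 1" "\<forall>i. i \<notin> T \<longrightarrow> d $ i = 0" for T d
    using that
  proof (induction T arbitrary: d rule: finite_induct)
    case empty
    then have "d = 0" by (simp add: vec_eq_iff)
    then show ?case by (simp add: piece_matrix_0)
  next
    case (insert i T)
    obtain \<alpha> \<beta> where aff: "\<And>t. det (piece_matrix Z L J Y (upd d i t)) = \<alpha> + \<beta> * t"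
      using det_piece_matrix_affine[OF L] by metis
    have "\<alpha> + \<beta> * t \<noteq> 0" if "\<bar>t\<bar> \<le> 1" for t
      unfolding aff[symmetric] using insert.prems that by (intro nz) (auto simp: upd_nth)
    then have "sgn (\<alpha> + \<beta> * d $ i) = sgn \<alpha>"
      using insert.prems by (intro affine_sgn_eq) auto
    moreover have "sgn (\<alpha> + \<beta> * 0) = sgn (det J)"
      unfolding aff[symmetric] using insert.prems insert.hyps
      by (intro insert.IH) (auto simp: upd_nth)
    ultimately show ?case using aff[of "d $ i"] by simp
  qed
  from this[of UNIV] show ?thesis using d by (simp add: mem_cube)
qed

section \<open>Affine pieces and coherent orientation\<close>

lemma anf_fun_piece:
  fixes c :: "real^('s::{finite,wellorder})"
  assumes L: "strictly_lower_triangular L"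
    and d: "\<bar>anf_switching c Z L x\<bar> = d * anf_switching c Z L x"
  shows "anf_fun c b Z L J Y x
    = piece_matrix Z L J Y d *v x + (b + Y *v (d * (switch_inv L d *v c)))"
proof -
  let ?z = "anf_switching c Z L x"
  have "?z = (c + Z *v x) + L *v (d * ?z)"
    using anf_switching_eq[OF L, of c Z x] unfolding d .
  then have "?z = switch_inv L d *v (c + Z *v x)"
    using switch_inv_eq_iff[OF L] by blast
  then have "d * ?z = d * (switch_inv L d *v c) + d * (switch_inv L d *v (Z *v x))"
    by (simp add: matrix_vector_right_distrib distrib_left)
  then show ?thesis
    unfolding anf_fun_def d piece_matrix_mult by (simp add: matrix_vector_right_distrib)
qed

text \<open>Forward substitution again: each entry is a continuous expression in \<open>x\<close>
  and the earlier entries.\<close>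

lemma continuous_on_anf_switching:
  fixes c :: "real^('s::{finite,wellorder})"
  assumes L: "strictly_lower_triangular L"
  shows "continuous_on UNIV (anf_switching c Z L)"
proof -
  let ?z = "anf_switching c Z L"
  have lin: "continuous_on UNIV (\<lambda>x. (Z *v x) $ i)" for i
    by (intro continuous_intros)
  have "continuous_on UNIV (\<lambda>x. ?z x $ i)" for i
  proof (induction i rule: less_induct)
    case (less i)
    have "?z x $ i = c $ i + (Z *v x) $ i + (\<Sum>j\<in>UNIV. L $ i $ j * \<bar>?z x $ j\<bar>)" for x
      using arg_cong[OF anf_switching_eq[OF L, of c Z x], of "\<lambda>v. v $ i"]
      by (simp add: matrix_vector_mult_def[of L] abs_vec_nth)
    moreover have "continuous_on UNIV (\<lambda>x. L $ i $ j * \<bar>?z x $ j\<bar>)" for j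
    proof (cases "j < i")
      case True
      then show ?thesis by (intro continuous_intros less.IH)
    next
      case False
      then show ?thesis using L by (simp add: strictly_lower_triangular_def)
    qed
    ultimately show ?case
      by (simp only:) (intro continuous_on_add continuous_on_const lin continuous_on_sum)
  qed
  then have "continuous_on UNIV (\<lambda>x. \<chi> i. ?z x $ i)" by (rule continuous_on_vec_lambda)
  then show ?thesis by simp
qed

lemma continuous_on_anf_fun:
  fixes c :: "real^('s::{finite,wellorder})"
  assumes L: "strictly_lower_triangular L"
  shows "continuous_on UNIV (anf_fun c b Z L J Y)"
proof -
  have "continuous_on UNIV (\<lambda>x. \<bar>anf_switching c Z L x\<bar>)"
    unfolding abs_vec_def
    by (intro continuous_on_vec_lambda continuous_intros continuous_on_anf_switching[OF L])
  then have "continuous_on UNIV (\<lambda>x. Y *v \<bar>anf_switching c Z L x\<bar>)"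
    by (rule continuous_on_compose2[OF matrix_vector_mult_linear_continuous_on]) auto
  then show ?thesis unfolding anf_fun_def by (intro continuous_intros)
qed

lemma finite_vertices: "finite {d::real^'s. \<forall>i. d $ i \<in> {-1, 1}}"
proof (rule finite_subset)
  show "{d::real^'s. \<forall>i. d $ i \<in> {-1, 1}} \<subseteq> vec_lambda ` (UNIV \<rightarrow>\<^sub>E {-1, 1})"
    by (auto intro!: image_eqI[where x="vec_nth _"])
qed (intro finite_imageI finite_PiE; simp)

lemma regular_imp_coherently_oriented:
  fixes c :: "real^('s::{finite,wellorder})"
  assumes L: "strictly_lower_triangular L" and reg: "regular Z L J Y"
  shows "coherently_oriented (anf_fun c b Z L J Y)"
proof -
  define V where "V = {d::real^('s::{finite,wellorder}). \<forall>i. d $ i \<in> {-1, 1}}"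
  define S where "S = (\<lambda>d. (piece_matrix Z L J Y d, b + Y *v (d * (switch_inv L d *v c)))) ` V"
  have "affine_selections S (anf_fun c b Z L J Y)"
    unfolding affine_selections_def
  proof (intro conjI allI)
    show "finite S" unfolding S_def V_def by (intro finite_imageI finite_vertices)
    fix x
    \<comment> \<open>Zero entries of the switching vector are given sign 1, so that
      \<open>d\<close> is always a vertex of the cube.\<close>
    define d :: "real^('s::{finite,wellorder})" where "d = (\<chi> i. if anf_switching c Z L x $ i \<ge> 0 then 1 else - 1)"
    have "d \<in> V" by (simp add: V_def d_def)
    moreover have "\<bar>anf_switching c Z L x\<bar> = d * anf_switching c Z L x"
      by (simp add: vec_eq_iff abs_vec_nth d_def)
    ultimately show "\<exists>(A, a)\<in>S. anf_fun c b Z L J Y x = A *v x + a"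
      using anf_fun_piece[OF L, of c Z x d b J Y] unfolding S_def by auto
  qed
  moreover have "V \<subseteq> cbox (-1) 1"
  proof
    fix d assume "d \<in> V"
    then have "d $ i \<in> {-1, 1}" for i unfolding V_def by blast
    then have "\<bar>d $ i\<bar> \<le> 1" for i by (metis abs_minus_cancel abs_one insertE order_refl singletonD)
    then show "d \<in> cbox (-1) 1" by (simp add: mem_cube)
  qed
  then have "\<forall>(A, a)\<in>S. sgn (det A) = sgn (det J)"
    using regular_det_sgn[OF L reg] by (auto simp: S_def)
  moreover have "det J \<noteq> 0"
    using reg unfolding regular_iff_piece_matrix[OF L]
    by (metis piece_matrix_0 mem_cube abs_zero zero_index zero_le_one)
  then have "sgn (det J) \<in> {-1, 1}" by (simp add: sgn_if)
  ultimately show ?thesis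
    using coherently_oriented_iff continuous_on_anf_fun[OF L] by blast
qed

text \<open>Since \<open>Z\<close> is surjective, each vertex \<open>d\<close> is itself a switching
  vector. Its sign pattern thus occurs on a nonempty open set, the corresponding piece is active,
  and all vertex determinants share one sign.\<close>

lemma surj_coherently_oriented_imp_regular:
  fixes c :: "real^('s::{finite,wellorder})"
  assumes L: "strictly_lower_triangular L" and Z: "surj ((*v) Z)"
    and co: "coherently_oriented (anf_fun c b Z L J Y)"
  shows "regular Z L J Y"
proof -
  obtain S \<sigma> where S: "affine_selections S (anf_fun c b Z L J Y)" "\<sigma> \<in> {-1, 1}"
    "\<And>A a. (A, a) \<in> S \<Longrightarrow> coincides_on_open (anf_fun c b Z L J Y) A a \<Longrightarrow> sgn (det A) = \<sigma>"
    using co unfolding coherently_oriented_def by blast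
  have "\<sigma> * det (piece_matrix Z L J Y d) > 0" if d: "\<forall>i. d $ i \<in> {-1, 1}" for d
  proof -
    define U where "U = {x. \<forall>i. 0 < d $ i * anf_switching c Z L x $ i}"
    have "U = (\<Inter>i\<in>UNIV. {x. 0 < d $ i * anf_switching c Z L x $ i})" by (auto simp: U_def)
    moreover have "open {x. 0 < d $ i * anf_switching c Z L x $ i}" for i
      by (intro open_Collect_less continuous_intros continuous_on_anf_switching[OF L])
    ultimately have "open U" by (simp add: open_INT)
    moreover have "U \<noteq> {}"
    proof -
      obtain x where x: "Z *v x = d - L *v \<bar>d\<bar> - c" using Z by (metis surjD)
      have "anf_switching c Z L x = d" by (rule anf_switching_eqI[OF L]) (simp add: x)
      moreover have "0 < d $ i * d $ i" for i using spec[OF d, of i] by auto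
      ultimately have "x \<in> U" by (simp add: U_def)
      then show ?thesis by blast
    qed
    moreover have "anf_fun c b Z L J Y x
        = piece_matrix Z L J Y d *v x + (b + Y *v (d * (switch_inv L d *v c)))" if "x \<in> U" for x
    proof (rule anf_fun_piece[OF L])
      have "\<bar>w\<bar> = e * w" if "0 < e * w" "e \<in> {-1, 1}" for e w :: real using that by auto
      then show "\<bar>anf_switching c Z L x\<bar> = d * anf_switching c Z L x"
        using that d by (simp add: U_def vec_eq_iff abs_vec_nth)
    qed
    ultimately have "coincides_on_open (anf_fun c b Z L J Y) (piece_matrix Z L J Y d)
        (b + Y *v (d * (switch_inv L d *v c)))"
      unfolding coincides_on_open_def by blast
    from affine_selections_open[OF S(1) this] have "sgn (det (piece_matrix Z L J Y d)) = \<sigma>"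
      using S(3) by blast
    with S(2) show ?thesis by (auto simp: sgn_if split: if_splits)
  qed
  then show ?thesis
    unfolding regular_iff_piece_matrix[OF L]
    using det_piece_matrix_vertices[OF L, of \<sigma> Z J Y] by (metis less_irrefl mult_zero_right)
qed

section \<open>Surjective perturbations of \<open>Z\<close>\<close>

lemma det_affine_line_poly:
  fixes A B :: "real^'n^'n"
  shows "\<exists>p. \<forall>t. poly p t = det (A + t *\<^sub>R B)"
proof
  let ?p = "\<Sum>q\<in>{q. q permutes (UNIV::'n set)}.
    smult (of_int (sign q)) (\<Prod>i\<in>UNIV. [:A $ i $ q i, B $ i $ q i:])"
  show "\<forall>t. poly ?p t = det (A + t *\<^sub>R B)"
    by (simp add: det_def poly_sum poly_prod)
qed

text \<open>The matrix is a coordinate projection after a scaled orthogonal map. The latter carries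
  \<open>q\<close> to the zero-extension \<open>E v\<close> of \<open>v\<close>, which projects back
  to \<open>v\<close>.\<close>

lemma exists_surj_matrix_mapping:
  fixes q :: "real^'n" and v :: "real^'s"
  assumes card: "CARD('s) \<le> CARD('n)" and q: "q \<noteq> 0" and v: "v \<noteq> 0"
  obtains W :: "real^'n^'s" where "surj ((*v) W)" "W *v q = v"
proof -
  obtain e :: "'s \<Rightarrow> 'n" where e: "inj e"
    using card_le_inj[of "UNIV::'s set" "UNIV::'n set"] card by auto
  define P where "P = (\<lambda>x::real^'n. \<chi> i. x $ e i)"
  define E where "E = (\<lambda>w::real^'s. \<chi> j. if j \<in> range e then w $ inv e j else 0)"
  have PE: "P (E w) = w" for w by (simp add: P_def E_def vec_eq_iff e)
  have E0: "E v \<noteq> 0" using v PE by (metis P_def vec_eq_iff vec_lambda_beta zero_index)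
  \<comment> \<open>An orthogonal map can only reach the multiple of \<open>E v\<close> with the
    norm of \<open>q\<close>; this factor corrects the length.\<close>
  let ?c = "norm (E v) / norm q"
  have "norm q = norm ((norm q / norm (E v)) *\<^sub>R E v)" using E0 by simp
  from orthogonal_transformation_exists[OF this]
  obtain f where f: "orthogonal_transformation f" "f q = (norm q / norm (E v)) *\<^sub>R E v" .
  define h where "h = (\<lambda>x. P (?c *\<^sub>R f x))"
  have "linear f" using f(1) by (rule orthogonal_transformation_linear)
  then have h: "linear h"
    unfolding h_def P_def
    by (intro linearI) (simp_all add: vec_eq_iff linear_add linear_scale algebra_simps)
  have "surj f" using f(1) by (rule orthogonal_transformation_surj)
  have "\<exists>x. w = h x" for w
  proof -
    obtain x where "f x = (1 / ?c) *\<^sub>R E w" using \<open>surj f\<close> by (metis surjD)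
    then have "h x = w" using q E0 PE by (simp add: h_def)
    then show ?thesis by blast
  qed
  moreover have "h q = v" using q E0 PE by (simp add: h_def f(2))
  moreover have "(*v) (matrix h) = h" using h by (simp add: fun_eq_iff matrix_works)
  ultimately show thesis using that[of "matrix h"] by (simp add: surj_def)
qed

lemma matrix_add_rdistrib: "(A + B) ** C = A ** C + (B ** C :: real^'p^'m)"
  by (simp add: vec_eq_iff matrix_matrix_mult_def distrib_right sum.distrib)

text \<open>Move from \<open>Z\<close> towards a surjective \<open>W\<close> that agrees with
  \<open>Z\<close> at \<open>q\<close>; the whole line then agrees there. With a right inverse
  \<open>R\<close> of \<open>W\<close>, the determinant of the product with \<open>R\<close> is a
  polynomial in the line parameter with value 1 at 1, so it is nonzero for arbitrarily small
  positive parameters.\<close>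

lemma exists_near_surj:
  fixes Z :: "real^'n^'s"
  assumes card: "CARD('s) \<le> CARD('n)" and q: "Z *v q \<noteq> 0" and \<epsilon>: "\<epsilon> > 0"
  obtains Z' where "norm (Z' - Z) < \<epsilon>" "surj ((*v) Z')" "Z' *v q = Z *v q"
proof -
  have "q \<noteq> 0" using q by auto
  obtain W :: "real^'n^'s" where W: "surj ((*v) W)" "W *v q = Z *v q"
    using exists_surj_matrix_mapping[OF card \<open>q \<noteq> 0\<close> q] by metis
  obtain R where R: "W ** R = mat 1"
    using W(1) unfolding matrix_right_invertible_surjective[symmetric] by blast
  obtain p where p: "\<And>t. poly p t = det (Z ** R + t *\<^sub>R ((W - Z) ** R))"
    using det_affine_line_poly by metis
  have "Z ** R + 1 *\<^sub>R ((W - Z) ** R) = mat 1"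
    unfolding R[symmetric]
    by (simp add: vec_eq_iff matrix_matrix_mult_def algebra_simps sum_subtractf)
  then have "poly p 1 = 1" unfolding p by simp
  then have "p \<noteq> 0" by auto
  then have "finite {t. poly p t = 0}" by (rule poly_roots_finite)
  \<comment> \<open>Adding 1 keeps the denominator positive even if \<open>W = Z\<close>.\<close>
  moreover define \<delta> where "\<delta> = \<epsilon> / (norm (W - Z) + 1)"
  have n1: "norm (W - Z) + 1 > 0" by (smt (verit) norm_ge_zero)
  have "\<delta> > 0" using \<epsilon> n1 by (simp add: \<delta>_def)
  then have "infinite {0<..<\<delta>}" by (simp add: infinite_Ioo)
  ultimately have "\<not> {0<..<\<delta>} \<subseteq> {t. poly p t = 0}" using finite_subset by blast
  then obtain t where "t \<in> {0<..<\<delta>}" "t \<notin> {t. poly p t = 0}"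
    by (metis subsetI)
  then have t: "0 < t" "t < \<delta>" "poly p t \<noteq> 0" by simp_all
  define Z' where "Z' = Z + t *\<^sub>R (W - Z)"
  have "norm (Z' - Z) = t * norm (W - Z)" using t by (simp add: Z'_def)
  also have "\<dots> \<le> t * (norm (W - Z) + 1)" using t by simp
  also have "\<dots> < \<delta> * (norm (W - Z) + 1)" using t n1 by (intro mult_strict_right_mono)
  also have "\<dots> = \<epsilon>" using n1 by (simp add: \<delta>_def)
  finally have near: "norm (Z' - Z) < \<epsilon>" .
  have "Z' ** R = Z ** R + t *\<^sub>R ((W - Z) ** R)"
    by (simp add: Z'_def matrix_add_rdistrib scalar_matrix_assoc[symmetric])
  then have "det (Z' ** R) \<noteq> 0" using t(3) p by simp
  then obtain Q where "Z' ** R ** Q = mat 1"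
    unfolding invertible_det_nz[symmetric] invertible_def by blast
  then have "surj ((*v) Z')"
    unfolding matrix_right_invertible_surjective[symmetric] by (metis matrix_mul_assoc)
  moreover have "Z' *v q = Z *v q"
    using W(2) by (simp add: Z'_def matrix_vector_mult_add_rdistrib matrix_vector_mult_diff_rdistrib
        scaleR_matrix_vector_assoc[symmetric])
  ultimately show thesis using near that by blast
qed

text \<open>In a singular triple \<open>Z *v x = 0\<close> would force \<open>z = 0\<close> by
  triangularity and then \<open>x = 0\<close> by invertibility of \<open>J\<close>. So
  \<open>exists_near_surj\<close> applies at \<open>x\<close> and preserves the triple.\<close>

lemma not_regular_near_surj:
  fixes Z :: "real^'n^('s::{finite,wellorder})"
  assumes L: "strictly_lower_triangular L" and J: "invertible J"
    and card: "CARD('s) \<le> CARD('n)" and nreg: "\<not> regular Z L J Y" and \<epsilon>: "\<epsilon> > 0"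
  obtains Z' where "norm (Z' - Z) < \<epsilon>" "surj ((*v) Z')" "\<not> regular Z' L J Y"
proof -
  obtain d x z where d: "d \<in> cbox (-1) 1" and eq: "J *v x + Y *v (d * z) = 0" "z = Z *v x + L *v (d * z)"
    and nz: "\<not> (x = 0 \<and> z = 0)"
    using nreg unfolding regular_def by blast
  have "Z *v x \<noteq> 0"
  proof
    assume "Z *v x = 0"
    then have z: "z = 0" using triangular_eq_0[OF L, of z d] eq(2) by simp
    then have "J *v x = 0" using eq(1) by simp
    then have "x = 0" using J unfolding invertible_left_inverse matrix_left_invertible_ker by blast
    with z nz show False by blast
  qed
  from exists_near_surj[OF card this \<epsilon>]
  obtain Z' where Z': "norm (Z' - Z) < \<epsilon>" "surj ((*v) Z')" "Z' *v x = Z *v x" by metis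
  have "\<not> regular Z' L J Y"
    unfolding regular_def using d eq nz Z'(3) by metis
  with Z' show thesis using that by blast
qed

section \<open>Equivalence of the five conditions\<close>

theorem theorem4p3:
  fixes c :: "real^('s::{finite,wellorder})" and b :: "real^'n"
    and Z :: "real^'n^('s::{finite,wellorder})" and L :: "real^('s::{finite,wellorder})^('s::{finite,wellorder})"
    and J :: "real^'n^'n" and Y :: "real^('s::{finite,wellorder})^'n"
  assumes "strictly_lower_triangular L"
    and "invertible J"
    and "CARD('s) \<le> CARD('n)"
  shows "(anf_stably_Z coherently_oriented c b Z L J Y
            \<longleftrightarrow> anf_stably_Z bij c b Z L J Y)
       \<and> (anf_stably_Z bij c b Z L J Y
            \<longleftrightarrow> anf_stably coherently_oriented c b Z L J Y)
       \<and> (anf_stably coherently_oriented c b Z L J Y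
            \<longleftrightarrow> anf_stably bij c b Z L J Y)
       \<and> (anf_stably bij c b Z L J Y
            \<longleftrightarrow> ave_uniquely_solvable (L - Z ** matrix_inv J ** Y))"
proof -
  have stably_Z: "anf_stably_Z P c b Z L J Y" if "anf_stably P c b Z L J Y"
    for P :: "(real^'n \<Rightarrow> real^'n) \<Rightarrow> bool"
  proof -
    from that obtain \<epsilon> where "\<epsilon> > 0"
      and \<epsilon>: "\<And>c' b' Z' L' J' Y'. strictly_lower_triangular L' \<and>
        norm (c' - c) < \<epsilon> \<and> norm (b' - b) < \<epsilon> \<and> norm (Z' - Z) < \<epsilon> \<and>
        norm (L' - L) < \<epsilon> \<and> norm (J' - J) < \<epsilon> \<and> norm (Y' - Y) < \<epsilon> \<Longrightarrow>
        P (anf_fun c' b' Z' L' J' Y')"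
      unfolding anf_stably_def by blast
    have "P (anf_fun c b Z' L J Y)" if "norm (Z' - Z) < \<epsilon>" for Z'
      by (rule \<epsilon>) (use that \<open>\<epsilon> > 0\<close> assms(1) in simp)
    with \<open>\<epsilon> > 0\<close> show ?thesis unfolding anf_stably_Z_def by blast
  qed
  have stably: "anf_stably P c b Z L J Y"
    if reg: "regular Z L J Y"
      and P: "\<And>(c::real^('s::{finite,wellorder})) b Z L J Y.
        strictly_lower_triangular L \<Longrightarrow> regular Z L J Y \<Longrightarrow> P (anf_fun c b Z L J Y)"
    for P :: "(real^'n \<Rightarrow> real^'n) \<Rightarrow> bool"
  proof -
    obtain \<epsilon> where "\<epsilon> > 0"
      and \<epsilon>: "\<And>Z' L' J' Y'. norm (Z' - Z) < \<epsilon> \<Longrightarrow> norm (L' - L) < \<epsilon> \<Longrightarrow> norm (J' - J) < \<epsilon> \<Longrightarrow>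
         norm (Y' - Y) < \<epsilon> \<Longrightarrow> regular Z' L' J' Y'"
      by (rule regular_stable[OF reg]) blast
    show ?thesis
      unfolding anf_stably_def
      by (intro exI[of _ \<epsilon>] conjI allI impI \<open>\<epsilon> > 0\<close> P \<epsilon>; elim conjE; assumption)
  qed
  have reg: "regular Z L J Y"
    if stable: "anf_stably_Z P c b Z L J Y"
      and P: "\<And>Z. surj ((*v) Z) \<Longrightarrow> P (anf_fun c b Z L J Y) \<Longrightarrow> regular Z L J Y"
    for P :: "(real^'n \<Rightarrow> real^'n) \<Rightarrow> bool"
  proof (rule ccontr)
    assume nreg: "\<not> regular Z L J Y"
    obtain \<epsilon> where "\<epsilon> > 0" and \<epsilon>: "\<And>Z'. norm (Z' - Z) < \<epsilon> \<Longrightarrow> P (anf_fun c b Z' L J Y)"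
      using stable unfolding anf_stably_Z_def by blast
    obtain Z' where "norm (Z' - Z) < \<epsilon>" "surj ((*v) Z')" "\<not> regular Z' L J Y"
      by (rule not_regular_near_surj[OF assms nreg \<open>\<epsilon> > 0\<close>])
    then show False using P \<epsilon> by blast
  qed
  \<comment> \<open>For both properties the circle closes: stability in all data gives stability in
    \<open>Z\<close>, which gives regularity, which gives stability in all data.\<close>
  note regular_iff_ave[OF assms(2), of Z L Y]
  moreover have "anf_stably_Z coherently_oriented c b Z L J Y \<Longrightarrow> regular Z L J Y"
    by (erule reg) (rule surj_coherently_oriented_imp_regular[OF assms(1)])
  moreover have "anf_stably_Z bij c b Z L J Y \<Longrightarrow> regular Z L J Y"
    by (erule reg) (rule surj_inj_imp_regular[OF assms(1) _ bij_is_inj])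
  moreover have "regular Z L J Y \<Longrightarrow> anf_stably coherently_oriented c b Z L J Y"
    by (erule stably) (rule regular_imp_coherently_oriented)
  moreover have "regular Z L J Y \<Longrightarrow> anf_stably bij c b Z L J Y"
    by (erule stably) (rule regular_imp_bij)
  ultimately show ?thesis using stably_Z by blast
qed

end
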